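(* Let $n,m\ge 1$, let $\mathcal{F}$ be a nonempty family of subsets of $\{1,\ldots,n\}$, let $f:\mathcal{F}\to\mathbb{R}$, and let $z:=\max\{f(S): S\in\mathcal{F}\}$. For $i=1,\ldots,m$ let $(\mathcal{P}_i,f_i)$ be an exact convex relaxation of this problem (as defined in the context), and for $\alpha\in\mathbb{R}^m$ let $$v(\alpha):=\max\left\{\sum_{i=1}^m \alpha_i f_i(x,\mathcal{X}^i)\ :\ (x,\mathcal{X}^i)\in\mathcal{P}_i,\ i=1,\ldots,m\right\},$$ where the same vector $x$ is shared by all $m$ relaxations. Then the function $v$ is convex on $\{\alpha\in\mathbb{R}^m:\alpha\ge 0\}$, and for all $\alpha\in\mathbb{R}^m$ such that $e'\alpha=1$ we have $v(\alpha)\ge z$.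
   Context: $e$ denotes the all-ones vector and $'$ denotes transpose, so $e'\alpha=\sum_i\alpha_i$; $\alpha\ge 0$ is componentwise. For $x\in\mathbb{R}^n$, the support of $x$ is $\underline{x}:=\{j: x_j\ne 0\}$; a vector $x\in\{0,1\}^n$ is the characteristic vector of $\underline{x}$. Exact convex relaxation: for each $i$, $\mathcal{P}_i$ is a convex set of points $(x,\mathcal{X}^i)$ with $x\in\mathbb{R}^n$ and $\mathcal{X}^i$ in some finite-dimensional real vector space (depending on $i$), such that the projection of $\mathcal{P}_i$ onto the $x$-coordinates is a subset of $[0,1]^n$ whose intersection with $\mathbb{Z}^n$ is precisely the set of characteristic vectors of members of $\mathcal{F}$. Moreover $f_i:\mathcal{P}_i\to\mathbb{R}$ is a concave function such that $f_i(x,\mathcal{X}^i)=f(\underline{x})$ for every $(x,\mathcal{X}^i)\in\mathcal{P}_i$ with $x\in\mathbb{Z}^n$. The maximum defining $v(\alpha)$ is interpreted as a supremum in $(-\infty,+\infty]$ (it is over a nonempty set), and convexity is in the extended-real-valued sense. *)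

theory Defs
  imports "HOL-Analysis.Analysis" "HOL-Library.Extended_Real"
begin

definition supp :: "real ^ 'n \<Rightarrow> 'n set" where
  "supp x = {j. x $ j \<noteq> 0}"

definition char_vec :: "'n set \<Rightarrow> real ^ 'n" where
  "char_vec S = (\<chi> j. if j \<in> S then 1 else 0)"

definition integral_vecs :: "(real ^ 'n) set" where
  "integral_vecs = {x. \<forall>j. x $ j \<in> \<int>}"

definition finite_dim_subspace :: "'b::real_vector set \<Rightarrow> bool" where
  "finite_dim_subspace V \<longleftrightarrow> (\<exists>B. finite B \<and> V = span B)"

(* V is the space of the auxiliary component. It is a subspace of the type 'b rather than
   a type of its own, so that relaxations living in different finite-dimensional spaces can
   be considered together: any finite family of such spaces embeds in a common 'b.
   The values of f outside F and of g outside P are irrelevant. *)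
definition exact_convex_relaxation ::
  "'n::finite set set \<Rightarrow> ('n set \<Rightarrow> real) \<Rightarrow> 'b::real_vector set
    \<Rightarrow> ((real ^ 'n) \<times> 'b) set \<Rightarrow> ((real ^ 'n) \<times> 'b \<Rightarrow> real) \<Rightarrow> bool" where
  "exact_convex_relaxation F f V P g \<longleftrightarrow>
     finite_dim_subspace V \<and>
     P \<subseteq> UNIV \<times> V \<and>
     convex P \<and>
     fst ` P \<subseteq> {x. \<forall>j. 0 \<le> x $ j \<and> x $ j \<le> 1} \<and>
     fst ` P \<inter> integral_vecs = char_vec ` F \<and>
     concave_on P g \<and>
     (\<forall>x X. (x, X) \<in> P \<and> x \<in> integral_vecs \<longrightarrow> g (x, X) = f (supp x))"

definition relaxation_value ::
  "('m::finite \<Rightarrow> ((real ^ 'n) \<times> 'b) set) \<Rightarrow> ('m \<Rightarrow> (real ^ 'n) \<times> 'b \<Rightarrow> real)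
    \<Rightarrow> real ^ 'm \<Rightarrow> ereal" where
  "relaxation_value P g \<alpha> =
     Sup {ereal (\<Sum>i\<in>UNIV. \<alpha> $ i * g i (x, X i)) | x X. \<forall>i. (x, X i) \<in> P i}"

(* Convexity for functions with values in (-\<infinity>, \<infinity>], in which no \<infinity> - \<infinity> can arise. *)
definition ereal_convex_on :: "'a::real_vector set \<Rightarrow> ('a \<Rightarrow> ereal) \<Rightarrow> bool" where
  "ereal_convex_on S h \<longleftrightarrow>
     convex S \<and> (\<forall>x\<in>S. h x \<noteq> -\<infinity>) \<and>
     (\<forall>x\<in>S. \<forall>y\<in>S. \<forall>t::real. 0 < t \<and> t < 1 \<longrightarrow>
        h ((1 - t) *\<^sub>R x + t *\<^sub>R y) \<le> ereal (1 - t) * h x + ereal t * h y)"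

end

theory Submission
  imports Defs
begin

text \<open>For a fixed feasible point the objective is linear in \<alpha>, so the value is a
  pointwise supremum of linear functions and hence convex
  (\<open>relaxation_value_convex_combination\<close>). For the bound, each S in \<open>F\<close>
  yields a feasible point with shared component \<open>char_vec S\<close>; every relaxation is exact
  there, so the objective is f S times the sum of the weights
  (\<open>relaxation_value_ge_member\<close>). With weights summing to 1, a maximizing S gives z.
  The same lemma keeps the value above -\<infinity>.\<close>

lemma supp_char_vec [simp]: "supp (char_vec S) = S"
  by (auto simp: supp_def char_vec_def)

lemma relaxation_value_upper:
  assumes "\<And>i. (x, X i) \<in> P i"
  shows "ereal (\<Sum>i\<in>UNIV. \<alpha> $ i * g i (x, X i)) \<le> relaxation_value P g \<alpha>"
  unfolding relaxation_value_def using assms by (intro Sup_upper) blast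

lemma relaxation_value_least:
  assumes "\<And>x X. (\<And>i. (x, X i) \<in> P i) \<Longrightarrow> ereal (\<Sum>i\<in>UNIV. \<alpha> $ i * g i (x, X i)) \<le> u"
  shows "relaxation_value P g \<alpha> \<le> u"
  unfolding relaxation_value_def using assms by (intro Sup_least) blast

text \<open>All m relaxations contain a lift of the same integral point \<open>char_vec S\<close>,
  and all of them assign it the objective f S whatever the signs of the weights.\<close>

lemma relaxation_value_ge_member:
  assumes "\<And>i. exact_convex_relaxation F f (V i) (P i) (g i)" and "S \<in> F"
  shows "ereal ((\<Sum>i\<in>UNIV. \<alpha> $ i) * f S) \<le> relaxation_value P g \<alpha>"
proof -
  have S: "char_vec S \<in> fst ` P i \<inter> integral_vecs" for i
    using assms unfolding exact_convex_relaxation_def by blast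
  then have "\<exists>X. (char_vec S, X) \<in> P i" for i
    by force
  \<comment> \<open>Only x is shared: the auxiliary components may be chosen separately for each
    i.\<close>
  then obtain X where X: "\<And>i. (char_vec S, X i) \<in> P i"
    by metis
  have "g i (char_vec S, X i) = f (supp (char_vec S))" for i
    using assms(1)[of i] X[of i] S[of i] unfolding exact_convex_relaxation_def by blast
  with relaxation_value_upper[of "char_vec S" X P \<alpha> g] X show ?thesis
    by (simp add: sum_distrib_right)
qed

text \<open>At each feasible point the objective splits linearly in the weights, and each part is
  bounded by its own supremum.\<close>

lemma relaxation_value_convex_combination:
  assumes "0 \<le> t" "t \<le> 1"
  shows "relaxation_value P g ((1 - t) *\<^sub>R \<alpha> + t *\<^sub>R \<beta>)
    \<le> ereal (1 - t) * relaxation_value P g \<alpha> + ereal t * relaxation_value P g \<beta>"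
proof (rule relaxation_value_least)
  fix x X assume X: "\<And>i. (x, X i) \<in> P i"
  let ?s = "\<lambda>\<gamma>. \<Sum>i\<in>UNIV. \<gamma> $ i * g i (x, X i)"
  have "?s ((1 - t) *\<^sub>R \<alpha> + t *\<^sub>R \<beta>) = (1 - t) * ?s \<alpha> + t * ?s \<beta>"
    by (simp add: sum_distrib_left sum.distrib[symmetric] algebra_simps)
  then have "ereal (?s ((1 - t) *\<^sub>R \<alpha> + t *\<^sub>R \<beta>)) = ereal (1 - t) * ereal (?s \<alpha>) + ereal t * ereal (?s \<beta>)"
    by simp
  \<comment> \<open>Nonnegativity of \<open>1 - t\<close> and \<open>t\<close> lets the bounds be
    scaled, even when a supremum is \<infinity>.\<close>
  also have "\<dots> \<le> ereal (1 - t) * relaxation_value P g \<alpha> + ereal t * relaxation_value P g \<beta>"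
    using assms X by (intro add_mono ereal_mult_left_mono relaxation_value_upper) auto
  finally show "ereal (?s ((1 - t) *\<^sub>R \<alpha> + t *\<^sub>R \<beta>))
      \<le> ereal (1 - t) * relaxation_value P g \<alpha> + ereal t * relaxation_value P g \<beta>" .
qed

theorem proposition1:
  fixes F :: "'n::finite set set"
    and f :: "'n set \<Rightarrow> real"
    and V :: "'m::finite \<Rightarrow> 'b::real_vector set"
    and P :: "'m \<Rightarrow> ((real ^ 'n) \<times> 'b) set"
    and g :: "'m \<Rightarrow> (real ^ 'n) \<times> 'b \<Rightarrow> real"
    and z :: real
  assumes "F \<noteq> {}"
    and "z = Max (f ` F)"
    and "\<And>i. exact_convex_relaxation F f (V i) (P i) (g i)"
  shows "ereal_convex_on {\<alpha>. \<forall>i. 0 \<le> \<alpha> $ i} (relaxation_value P g)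
    \<and> (\<forall>\<alpha>::real ^ 'm. (\<Sum>i\<in>UNIV. \<alpha> $ i) = 1 \<longrightarrow> ereal z \<le> relaxation_value P g \<alpha>)"
proof (intro conjI allI impI)
  obtain S where "S \<in> F"
    using assms(1) by blast
  \<comment> \<open>A single member of \<open>F\<close> already gives a finite lower bound.\<close>
  then have "relaxation_value P g \<alpha> \<noteq> -\<infinity>" for \<alpha>
    using relaxation_value_ge_member[of F f V P g S \<alpha>] assms(3) by auto
  moreover have "convex {\<alpha> :: real ^ 'm. \<forall>i. 0 \<le> \<alpha> $ i}"
    by (simp add: convex_def)
  ultimately show "ereal_convex_on {\<alpha>. \<forall>i. 0 \<le> \<alpha> $ i} (relaxation_value P g)"
    by (simp add: ereal_convex_on_def relaxation_value_convex_combination)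
next
  fix \<alpha> :: "real ^ 'm"
  assume "(\<Sum>i\<in>UNIV. \<alpha> $ i) = 1"
  \<comment> \<open>The maximum is attained: \<open>F\<close> is nonempty, and finite because
    \<open>'n\<close> is.\<close>
  moreover have "z \<in> f ` F"
    using assms(1,2) by simp
  ultimately show "ereal z \<le> relaxation_value P g \<alpha>"
    using relaxation_value_ge_member[of F f V P g _ \<alpha>] assms(3) by auto
qed

end
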